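(* Let $X$ be a $T_0$ topological space. The following are equivalent. (1) The open blobs of $X$ form a monoidal base of $X$, and for all $A \subset X$, the set $\bigcap_{x \in A} \overline{\{x\}}$ is the closure of a point of $X$. (2) If $B$ denotes the set of open blobs of $X$, then $(X,B)$ is an $\mathbb{M}$-complete join semilattice. (3) There exists a monoidal base $B$ of $X$ such that $(X,B)$ is an $\mathbb{M}$-complete join semilattice. (4) There exists a monoidal base $B$ of $X$ such that $(X,B) \cong E(X,B)$ in $\mathbb{M}$. (5) There exists a monoidal base $B$ of $X$ and an object $(Y,C)$ of $\mathbb{M}$ such that $(X,B) \cong E(Y,C)$ in $\mathbb{M}$.
   Context: Blob: a subset $A$ of a topological space $X$ is a blob if there exists $a \in X$ such that $A$ is the intersection of all open subsets of $X$ which contain $a$. An open blob is a blob that is open. Monoidal base: a base $B$ of open sets of a topological space $X$ is monoidal if $X \in B$ and $B$ is closed under finite intersections. Category $\mathbb{M}$: objects are pairs $(X,B)$ where $X$ is a $T_0$ space and $B$ is a monoidal base of $X$. A morphism $(X,B) \to (Y,C)$ is a function $f: X \to Y$ such that $f^{-1}(U) \in B$ for all $U \in C$. The symbol $\cong$ denotes isomorphism in $\mathbb{M}$. Complete join semilattice: a poset $(P,\le)$ in which every subset $A \subset P$ (including the empty set) has a least upper bound $\sup(A) \in P$. $\mathbb{M}$-complete join semilattice: an object $(X,B)$ of $\mathbb{M}$ such that there is a partial order $\le$ on $X$ for which $(X,\le)$ is a complete join semilattice and, for all $A \subset X$ and all $U \in B$, $A \subset U \iff \sup(A) \in U$. (In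 particular $B$ is required to be a monoidal base of $X$.) Exponential $E(X,B)$: for an object $(X,B)$ of $\mathbb{M}$, give the power set $\mathcal{P}(X)$ the topology with base $\{\mathcal{P}(U) : U \in B\}$, and let $A \sim A'$ if and only if $A$ and $A'$ belong to the same open sets of $\mathcal{P}(X)$. Then $E(X,B)$ is the quotient space $\mathcal{P}(X)/\sim$ equipped with the monoidal base $\widetilde{B} = \{\widetilde{U} : U \in B\}$, where $\widetilde{U} = \{[A] \in \mathcal{P}(X)/\sim \; : A \subset U\}$ and $[A]$ denotes the equivalence class of $A$. It is an object of $\mathbb{M}$. Convention: the intersection over the empty subset $A=\varnothing$ of $X$ is $X$. *)

theory Defs
  imports "HOL-Analysis.Analysis"
begin

definition blob_in :: "'a topology \<Rightarrow> 'a set \<Rightarrow> bool" where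
  "blob_in X A \<longleftrightarrow> (\<exists>a\<in>topspace X. A = \<Inter>{U. openin X U \<and> a \<in> U})"

definition open_blobs :: "'a topology \<Rightarrow> 'a set set" where
  "open_blobs X = {A. openin X A \<and> blob_in X A}"

definition monoidal_base :: "'a topology \<Rightarrow> 'a set set \<Rightarrow> bool" where
  "monoidal_base X B \<longleftrightarrow>
     openin X = arbitrary union_of (\<lambda>U. U \<in> B) \<and>
     topspace X \<in> B \<and> (\<forall>U\<in>B. \<forall>V\<in>B. U \<inter> V \<in> B)"

text \<open>The category \<open>M\<close>. As usual for carriers that are proper subsets of a type, functions
  matter only through their values on the carrier.\<close>

definition M_object :: "'a topology \<times> 'a set set \<Rightarrow> bool" where
  "M_object = (\<lambda>(X, B). t0_space X \<and> monoidal_base X B)"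

definition M_morphism ::
  "'a topology \<times> 'a set set \<Rightarrow> 'b topology \<times> 'b set set \<Rightarrow> ('a \<Rightarrow> 'b) \<Rightarrow> bool" where
  "M_morphism = (\<lambda>(X, B) (Y, C) f.
     M_object (X, B) \<and> M_object (Y, C) \<and>
     f \<in> topspace X \<rightarrow> topspace Y \<and> (\<forall>U\<in>C. {x \<in> topspace X. f x \<in> U} \<in> B))"

definition M_isomorphic ::
  "'a topology \<times> 'a set set \<Rightarrow> 'b topology \<times> 'b set set \<Rightarrow> bool" (infix \<open>\<cong>\<^sub>M\<close> 50) where
  "P \<cong>\<^sub>M Q \<longleftrightarrow>
     (\<exists>f g. M_morphism P Q f \<and> M_morphism Q P g \<and>
            (\<forall>x\<in>topspace (fst P). g (f x) = x) \<and> (\<forall>y\<in>topspace (fst Q). f (g y) = y))"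

definition is_sup :: "'a set \<Rightarrow> 'a rel \<Rightarrow> 'a set \<Rightarrow> 'a \<Rightarrow> bool" where
  "is_sup P r A s \<longleftrightarrow>
     s \<in> P \<and> (\<forall>a\<in>A. (a, s) \<in> r) \<and> (\<forall>t\<in>P. (\<forall>a\<in>A. (a, t) \<in> r) \<longrightarrow> (s, t) \<in> r)"

definition sup_in :: "'a set \<Rightarrow> 'a rel \<Rightarrow> 'a set \<Rightarrow> 'a" where
  "sup_in P r A = (THE s. is_sup P r A s)"

definition complete_join_semilattice :: "'a set \<Rightarrow> 'a rel \<Rightarrow> bool" where
  "complete_join_semilattice P r \<longleftrightarrow>
     partial_order_on P r \<and> (\<forall>A\<subseteq>P. \<exists>s. is_sup P r A s)"

definition M_complete_join_semilattice :: "'a topology \<times> 'a set set \<Rightarrow> bool" where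
  "M_complete_join_semilattice = (\<lambda>(X, B).
     M_object (X, B) \<and>
     (\<exists>r. complete_join_semilattice (topspace X) r \<and>
        (\<forall>A\<subseteq>topspace X. \<forall>U\<in>B. A \<subseteq> U \<longleftrightarrow> sup_in (topspace X) r A \<in> U)))"

definition power_topology :: "'a set set \<Rightarrow> 'a set topology" where
  "power_topology B = topology (arbitrary union_of (\<lambda>S. \<exists>U\<in>B. S = Pow U))"

definition same_opens :: "'a topology \<Rightarrow> 'a rel" where
  "same_opens T = {(x, y). x \<in> topspace T \<and> y \<in> topspace T \<and>
                           (\<forall>V. openin T V \<longrightarrow> (x \<in> V \<longleftrightarrow> y \<in> V))}"

definition quotient_topology :: "'a topology \<Rightarrow> 'a rel \<Rightarrow> 'a set topology" where
  "quotient_topology T r = topology (\<lambda>W. W \<subseteq> topspace T // r \<and> openin T (\<Union>W))"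

definition exponential ::
  "'a topology \<times> 'a set set \<Rightarrow> 'a set set topology \<times> 'a set set set set" where
  "exponential = (\<lambda>(X, B).
     let T = power_topology B; r = same_opens T in
       (quotient_topology T r, {{r `` {A} | A. A \<subseteq> U} | U. U \<in> B}))"

text \<open>The following facts show that the two uses of \<^const>\<open>topology\<close> above are legitimate and that
  \<^const>\<open>exponential\<close> takes objects to objects.\<close>

lemma openin_power_topology:
  assumes "monoidal_base X B"
  shows "openin (power_topology B) = arbitrary union_of (\<lambda>S. \<exists>U\<in>B. S = Pow U)"
  unfolding power_topology_def
proof (rule topology_inverse', rule istopology_base)
  fix S T assume "\<exists>U\<in>B. S = Pow U" "\<exists>U\<in>B. T = Pow U"
  then show "\<exists>U\<in>B. S \<inter> T = Pow U"
    using assms unfolding monoidal_base_def by (metis Pow_Int_eq)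
qed

lemma equiv_same_opens: "equiv (topspace T) (same_opens T)"
  by (auto simp: equiv_def refl_on_def sym_def trans_def same_opens_def)

lemma openin_quotient_topology:
  assumes "equiv (topspace T) r"
  shows "openin (quotient_topology T r) W \<longleftrightarrow> W \<subseteq> topspace T // r \<and> openin T (\<Union>W)"
proof -
  have "istopology (\<lambda>W. W \<subseteq> topspace T // r \<and> openin T (\<Union>W))"
    unfolding istopology_def
  proof (intro conjI allI impI; (elim conjE)?)
    fix V W assume V: "V \<subseteq> topspace T // r" "openin T (\<Union>V)"
      and W: "W \<subseteq> topspace T // r" "openin T (\<Union>W)"
    have "\<Union>(V \<inter> W) = \<Union>V \<inter> \<Union>W"
    proof
      show "\<Union>V \<inter> \<Union>W \<subseteq> \<Union>(V \<inter> W)"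
      proof
        fix x assume "x \<in> \<Union>V \<inter> \<Union>W"
        then obtain v w where "v \<in> V" "w \<in> W" "x \<in> v" "x \<in> w" by blast
        moreover from this have "v = w"
          using quotient_disj[OF assms] V(1) W(1) by blast
        ultimately show "x \<in> \<Union>(V \<inter> W)" by blast
      qed
    qed blast
    then show "openin T (\<Union>(V \<inter> W))" using V W by auto
  next
    fix \<K> assume "\<forall>K\<in>\<K>. K \<subseteq> topspace T // r \<and> openin T (\<Union>K)"
    moreover have "\<Union>(\<Union>\<K>) = \<Union>(Union ` \<K>)" by blast
    ultimately show "openin T (\<Union>(\<Union>\<K>))" by auto
  qed blast+
  then show ?thesis unfolding quotient_topology_def by simp
qed

lemma topspace_power_topology:
  assumes "monoidal_base X B"
  shows "topspace (power_topology B) = Pow (topspace X)"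
proof -
  have sub: "U \<subseteq> topspace X" if "U \<in> B" for U
  proof -
    have "openin X U"
      using assms that by (auto simp: monoidal_base_def arbitrary_def intro!: union_of_inc)
    then show ?thesis by (rule openin_subset)
  qed
  have "openin (power_topology B) (Pow (topspace X))"
    unfolding openin_power_topology[OF assms]
    using assms by (auto simp: monoidal_base_def arbitrary_def intro!: union_of_inc)
  moreover have "S \<subseteq> Pow (topspace X)" if "openin (power_topology B) S" for S
    using that sub unfolding openin_power_topology[OF assms] union_of_def by blast
  ultimately show ?thesis
    by (metis openin_subset openin_topspace subset_antisym)
qed

lemma topspace_quotient_topology:
  assumes "equiv (topspace T) r"
  shows "topspace (quotient_topology T r) = topspace T // r"
proof
  show "topspace (quotient_topology T r) \<subseteq> topspace T // r"
    using openin_quotient_topology[OF assms] openin_topspace by blast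
  have "openin (quotient_topology T r) (topspace T // r)"
    by (simp add: openin_quotient_topology[OF assms] Union_quotient[OF assms])
  then show "topspace T // r \<subseteq> topspace (quotient_topology T r)" by (rule openin_subset)
qed

lemma M_object_exponential:
  assumes "M_object (X, B)"
  shows "M_object (exponential (X, B))"
proof -
  define T where "T = power_topology B"
  define r where "r = same_opens T"
  define cl where "cl A = r `` {A}" for A
  define Q where "Q = quotient_topology T r"
  define tl where "tl U = {cl A | A. A \<subseteq> U}" for U
  have mb: "monoidal_base X B" using assms by (simp add: M_object_def)
  have top: "topspace T = Pow (topspace X)"
    unfolding T_def by (rule topspace_power_topology[OF mb])
  have opT: "openin T = arbitrary union_of (\<lambda>S. \<exists>U\<in>B. S = Pow U)"
    unfolding T_def by (rule openin_power_topology[OF mb])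
  have eq: "equiv (topspace T) r" unfolding r_def by (rule equiv_same_opens)
  have opQ: "openin Q W \<longleftrightarrow> W \<subseteq> topspace T // r \<and> openin T (\<Union>W)" for W
    unfolding Q_def by (rule openin_quotient_topology[OF eq])
  have topQ: "topspace Q = topspace T // r"
    unfolding Q_def by (rule topspace_quotient_topology[OF eq])
  have opT': "\<exists>U\<in>B. A \<subseteq> U \<and> Pow U \<subseteq> V" if "openin T V" "A \<in> V" for A V
  proof -
    have "\<exists>S. (\<exists>U\<in>B. S = Pow U) \<and> A \<in> S \<and> S \<subseteq> V"
      using opT[unfolded openin_topology_base_unique] that by simp
    then show ?thesis by auto
  qed
  have PowT: "openin T (Pow U)" if "U \<in> B" for U
    unfolding opT using that by (auto simp: arbitrary_def intro!: union_of_inc)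
  have sub: "Pow U \<subseteq> topspace T" if "U \<in> B" for U
    using PowT[OF that] by (rule openin_subset)
  have sat: "A \<in> V \<longleftrightarrow> A' \<in> V" if "(A, A') \<in> r" "openin T V" for A A' V
    using that by (simp add: r_def same_opens_def)
  have clself: "A \<in> cl A" if "A \<in> topspace T" for A
    unfolding cl_def using equiv_class_self[OF eq that] .
  have Utl: "\<Union>(tl U) = Pow U" if "U \<in> B" for U
  proof
    show "\<Union>(tl U) \<subseteq> Pow U"
      using sat[OF _ PowT[OF that]] by (auto simp: tl_def cl_def)
    show "Pow U \<subseteq> \<Union>(tl U)"
    proof
      fix A assume "A \<in> Pow U"
      then have "A \<in> cl A" "cl A \<in> tl U"
        using clself sub[OF that] by (auto simp only: tl_def)
      then show "A \<in> \<Union>(tl U)" by (rule UnionI[rotated])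
    qed
  qed
  have tlq: "tl U \<subseteq> topspace T // r" if "U \<in> B" for U
    using sub[OF that] by (auto simp: tl_def cl_def intro!: quotientI)
  have optl: "openin Q (tl U)" if "U \<in> B" for U
    using opQ PowT Utl tlq that by simp
  have memtl: "cl A \<in> tl U \<longleftrightarrow> A \<subseteq> U" if "U \<in> B" "A \<in> topspace T" for A U
  proof
    assume "cl A \<in> tl U"
    then have "A \<in> \<Union>(tl U)" using clself[OF that(2)] by blast
    then show "A \<subseteq> U" using Utl[OF that(1)] by blast
  qed (auto simp: tl_def)
  have qcl: "\<exists>A\<in>topspace T. x = cl A" if "x \<in> topspace T // r" for x
    using that by (auto simp: quotient_def cl_def)
  have base: "openin Q = arbitrary union_of (\<lambda>W. W \<in> {tl U | U. U \<in> B})"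
    unfolding openin_topology_base_unique
  proof (intro conjI allI impI; (elim conjE)?)
    fix W assume "W \<in> {tl U | U. U \<in> B}"
    then show "openin Q W" using optl by blast
  next
    fix W x assume W: "openin Q W" "x \<in> W"
    then obtain A where A: "A \<in> topspace T" "x = cl A" using opQ qcl by blast
    have "A \<in> \<Union>W" using clself A W(2) by blast
    moreover have "openin T (\<Union>W)" using W opQ by simp
    ultimately obtain U where U: "U \<in> B" "A \<subseteq> U" "Pow U \<subseteq> \<Union>W"
      using opT' by meson
    have "tl U \<subseteq> W"
    proof
      fix y assume "y \<in> tl U"
      then obtain A' where A': "A' \<subseteq> U" "y = cl A'" by (auto simp: tl_def)
      then obtain w where w: "w \<in> W" "A' \<in> w" using U by blast
      have wq: "w \<in> topspace T // r" using W(1) w(1) opQ by blast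
      have yq: "y \<in> topspace T // r" using tlq[OF U(1)] \<open>y \<in> tl U\<close> by blast
      have "A' \<in> y" using clself A' sub[OF U(1)] by blast
      then have "y = w" using quotient_disj[OF eq wq yq] w(2) by blast
      then show "y \<in> W" using w by simp
    qed
    moreover have "x \<in> tl U" using U A by (auto simp: tl_def)
    ultimately show "\<exists>V. V \<in> {tl U | U. U \<in> B} \<and> x \<in> V \<and> V \<subseteq> W" using U by blast
  qed
  have top_tl: "topspace Q = tl (topspace X)"
    unfolding topQ using top by (auto simp: tl_def cl_def quotient_def)
  have int_tl: "tl U \<inter> tl V = tl (U \<inter> V)" if "U \<in> B" "V \<in> B" for U V
  proof
    show "tl U \<inter> tl V \<subseteq> tl (U \<inter> V)"
    proof
      fix x assume x: "x \<in> tl U \<inter> tl V"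
      then obtain A where A: "A \<subseteq> U" "x = cl A" by (auto simp: tl_def)
      then have "A \<in> topspace T" using sub[OF that(1)] by blast
      then have "A \<subseteq> V" using memtl[OF that(2)] x A by blast
      then show "x \<in> tl (U \<inter> V)" using A by (auto simp: tl_def)
    qed
  qed (auto simp: tl_def)
  have "monoidal_base Q {tl U | U. U \<in> B}"
    unfolding monoidal_base_def
  proof (intro conjI ballI)
    show "topspace Q \<in> {tl U |U. U \<in> B}"
      using top_tl mb by (auto simp: monoidal_base_def)
  next
    fix V W assume "V \<in> {tl U |U. U \<in> B}" "W \<in> {tl U |U. U \<in> B}"
    then show "V \<inter> W \<in> {tl U |U. U \<in> B}"
      using int_tl mb unfolding monoidal_base_def by blast
  qed (rule base)
  moreover have "t0_space Q"
    unfolding t0_space_def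
  proof (intro ballI impI)
    fix x y assume "x \<in> topspace Q" "y \<in> topspace Q" "x \<noteq> y"
    then obtain A A' where A: "A \<in> topspace T" "x = cl A" "A' \<in> topspace T" "y = cl A'"
      using topQ qcl by metis
    have "(A, A') \<notin> r" using \<open>x \<noteq> y\<close> A equiv_class_eq[OF eq] unfolding cl_def by blast
    then obtain V where "openin T V" "A \<in> V \<longleftrightarrow> A' \<notin> V"
      using A by (auto simp: r_def same_opens_def)
    then obtain U where "U \<in> B" "A \<subseteq> U \<longleftrightarrow> \<not> A' \<subseteq> U"
      using opT'[of V A] opT'[of V A'] by (metis PowI subsetD)
    then show "\<exists>U. openin Q U \<and> (x \<notin> U \<longleftrightarrow> y \<in> U)"
      using optl[of U] memtl[of U A] memtl[of U A'] A by metis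
  qed
  ultimately have "M_object (Q, {tl U | U. U \<in> B})" by (simp add: M_object_def)
  then show ?thesis
    by (simp add: exponential_def Let_def Q_def T_def r_def tl_def cl_def)
qed

end

theory Submission
  imports Defs
begin

text \<open>Say that a point \<open>p\<close> represents a set \<open>A\<close> when every \<open>U \<in> B\<close> includes \<open>A\<close> iff it contains
  \<open>p\<close>. All five conditions say that \<open>X\<close> has a monoidal base \<open>B\<close> for which every subset of \<open>X\<close> is
  represented.

  A suitable order has no freedom: comparing \<open>y\<close> with \<open>sup {x, y}\<close> shows that \<open>x \<le> y\<close> iff \<open>y\<close> lies
  in the closure of \<open>{x}\<close>. For this order the upper bounds of \<open>A\<close> form the intersection of the closures
  of the points of \<open>A\<close>, and a representing point is a supremum. Hence \<open>M\<close>-complete join semilattices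
  are exactly the objects in which all subsets are represented
  (\<open>M_complete_join_semilattice_iff\<close>). The base has no freedom either: a \<open>U \<in> B\<close> contains the point
  representing \<open>U\<close> itself, so it is the blob of that point, and the base must be the set of open blobs
  (\<open>representable_base_eq_open_blobs\<close>). If conversely every \<open>U \<in> B\<close> is the blob of some point \<open>u\<close>,
  then \<open>A \<subseteq> U\<close> says that \<open>u\<close> lies in all closures of points of \<open>A\<close>. This turns representability into
  the condition on closures.

  Subsets are represented in every exponential, by the class of a union, and representability passes
  to isomorphic objects. Conversely, if subsets of \<open>X\<close> are represented, then each class in
  the exponential contains a singleton, and \<open>x \<mapsto> [{x}]\<close> is an isomorphism.\<close>

section \<open>Bases and the specialization order\<close>

lemma monoidal_base_openin:
  assumes "monoidal_base X B" "U \<in> B"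
  shows "openin X U"
  using assms by (auto simp: monoidal_base_def arbitrary_def intro!: union_of_inc)

lemma monoidal_base_subset:
  assumes "monoidal_base X B" "U \<in> B"
  shows "U \<subseteq> topspace X"
  using monoidal_base_openin[OF assms] by (rule openin_subset)

lemma monoidal_base_refine:
  assumes "monoidal_base X B" "openin X V" "x \<in> V"
  obtains U where "U \<in> B" "x \<in> U" "U \<subseteq> V"
proof -
  have "openin X = arbitrary union_of (\<lambda>U. U \<in> B)"
    using assms(1) by (simp add: monoidal_base_def)
  then show thesis
    using assms(2,3) that unfolding openin_topology_base_unique by meson
qed

lemma in_closure_of_singleton_base:
  assumes "monoidal_base X B" "x \<in> topspace X"
  shows "y \<in> X closure_of {x} \<longleftrightarrow> y \<in> topspace X \<and> (\<forall>U\<in>B. y \<in> U \<longrightarrow> x \<in> U)"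
proof (intro iffI conjI ballI impI)
  fix U assume "y \<in> X closure_of {x}" "U \<in> B" "y \<in> U"
  then show "x \<in> U"
    using monoidal_base_openin[OF assms(1)] by (auto simp: in_closure_of)
next
  assume y: "y \<in> topspace X \<and> (\<forall>U\<in>B. y \<in> U \<longrightarrow> x \<in> U)"
  have "x \<in> V" if V: "openin X V" "y \<in> V" for V
  proof -
    obtain U where "U \<in> B" "y \<in> U" "U \<subseteq> V"
      using monoidal_base_refine[OF assms(1) V] .
    then show ?thesis using y by blast
  qed
  then show "y \<in> X closure_of {x}"
    using y by (auto simp: in_closure_of)
qed (simp add: in_closure_of)

lemma t0_base_eqI:
  assumes "M_object (X, B)" "x \<in> topspace X" "y \<in> topspace X"
    and "\<And>U. U \<in> B \<Longrightarrow> x \<in> U \<longleftrightarrow> y \<in> U"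
  shows "x = y"
proof (rule ccontr)
  assume "x \<noteq> y"
  have mb: "monoidal_base X B" and "t0_space X"
    using assms(1) by (auto simp: M_object_def)
  then obtain V where "openin X V" "x \<notin> V \<longleftrightarrow> y \<in> V"
    using assms(2,3) \<open>x \<noteq> y\<close> by (auto simp: t0_space_def)
  then show False
    using monoidal_base_refine[OF mb] assms(4) by (metis subsetD)
qed

lemma blob_eq_closures:
  assumes "a \<in> topspace X"
  shows "\<Inter>{U. openin X U \<and> a \<in> U} = {x \<in> topspace X. a \<in> X closure_of {x}}"
  using assms by (auto simp: in_closure_of)

section \<open>Sets represented by points\<close>

definition represents :: "'a set set \<Rightarrow> 'a set \<Rightarrow> 'a \<Rightarrow> bool" where
  "represents B A p \<longleftrightarrow> (\<forall>U\<in>B. A \<subseteq> U \<longleftrightarrow> p \<in> U)"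

definition representable :: "'a topology \<times> 'a set set \<Rightarrow> bool" where
  "representable = (\<lambda>(X, B). \<forall>A\<subseteq>topspace X. \<exists>p\<in>topspace X. represents B A p)"

text \<open>A member \<open>U\<close> of the base contains the point \<open>u\<close> representing it, and every base set around \<open>u\<close>
  includes \<open>U\<close>, so \<open>U\<close> is the blob of \<open>u\<close>. An open blob is the least open set
  around its point, and the base has a member between the point and the blob.\<close>

lemma representable_base_eq_open_blobs:
  assumes "monoidal_base X B" "representable (X, B)"
  shows "B = open_blobs X"
proof (intro equalityI subsetI)
  fix U assume U: "U \<in> B"
  then obtain u where u: "u \<in> topspace X" "represents B U u"
    using assms monoidal_base_subset unfolding representable_def by blast
  then have "u \<in> U" using U by (auto simp: represents_def)
  have "U \<subseteq> V" if V: "openin X V" "u \<in> V" for V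
  proof -
    obtain W where "W \<in> B" "u \<in> W" "W \<subseteq> V"
      using monoidal_base_refine[OF assms(1) V] .
    then show ?thesis using u(2) by (auto simp: represents_def)
  qed
  then have "U = \<Inter>{V. openin X V \<and> u \<in> V}"
    using \<open>u \<in> U\<close> monoidal_base_openin[OF assms(1) U] by blast
  then show "U \<in> open_blobs X"
    using u U monoidal_base_openin[OF assms(1)] unfolding open_blobs_def blob_in_def by blast
next
  fix U assume "U \<in> open_blobs X"
  then obtain a where a: "openin X U" "a \<in> topspace X" "U = \<Inter>{V. openin X V \<and> a \<in> V}"
    by (auto simp: open_blobs_def blob_in_def)
  then have "a \<in> U" by simp
  then obtain V where V: "V \<in> B" "a \<in> V" "V \<subseteq> U"
    by (rule monoidal_base_refine[OF assms(1) a(1)])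
  have "U \<subseteq> V"
    unfolding a(3) by (rule Inter_lower) (simp add: V monoidal_base_openin[OF assms(1)])
  then show "U \<in> B" using V by simp
qed

text \<open>Both sides of the equation collect the points all of whose neighbourhoods in \<open>B\<close> include \<open>A\<close>.\<close>

lemma Inter_closures_eq_closure_of_representing:
  assumes "monoidal_base X B" "A \<subseteq> topspace X" "p \<in> topspace X" "represents B A p"
  shows "topspace X \<inter> (\<Inter>x\<in>A. X closure_of {x}) = X closure_of {p}"
proof (rule set_eqI)
  fix y
  have "y \<in> topspace X \<inter> (\<Inter>x\<in>A. X closure_of {x}) \<longleftrightarrow>
      y \<in> topspace X \<and> (\<forall>x\<in>A. \<forall>U\<in>B. y \<in> U \<longrightarrow> x \<in> U)"
    using assms(2) in_closure_of_singleton_base[OF assms(1)] by (auto simp: subset_iff)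
  also have "\<dots> \<longleftrightarrow> y \<in> topspace X \<and> (\<forall>U\<in>B. y \<in> U \<longrightarrow> A \<subseteq> U)"
    by (simp add: subset_iff) blast
  also have "\<dots> \<longleftrightarrow> y \<in> X closure_of {p}"
    using assms(3,4) by (simp add: in_closure_of_singleton_base[OF assms(1)] represents_def)
  finally show "y \<in> topspace X \<inter> (\<Inter>x\<in>A. X closure_of {x}) \<longleftrightarrow> y \<in> X closure_of {p}" .
qed

text \<open>The blob of \<open>u\<close> includes \<open>A\<close> iff \<open>u\<close> lies in the closure of each point of \<open>A\<close>, and it contains \<open>p\<close> iff
  \<open>u\<close> lies in the closure of \<open>p\<close>. The equation says that these agree for every \<open>u\<close>.\<close>

lemma closure_imp_represents_open_blobs:
  assumes A: "A \<subseteq> topspace X" and p: "p \<in> topspace X"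
    and eq: "topspace X \<inter> (\<Inter>x\<in>A. X closure_of {x}) = X closure_of {p}"
  shows "represents (open_blobs X) A p"
  unfolding represents_def
proof
  fix U assume "U \<in> open_blobs X"
  then obtain u where u: "u \<in> topspace X" "U = \<Inter>{V. openin X V \<and> u \<in> V}"
    unfolding open_blobs_def blob_in_def by blast
  then have U: "U = {x \<in> topspace X. u \<in> X closure_of {x}}"
    using blob_eq_closures by simp
  have "A \<subseteq> U \<longleftrightarrow> u \<in> topspace X \<inter> (\<Inter>x\<in>A. X closure_of {x})"
    using A u(1) U by auto
  also have "\<dots> \<longleftrightarrow> p \<in> U"
    unfolding eq using p U by simp
  finally show "A \<subseteq> U \<longleftrightarrow> p \<in> U" .
qed

section \<open>Representing points as suprema\<close>

lemma is_sup_unique: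
  assumes "partial_order_on P r" "is_sup P r A s" "is_sup P r A t"
  shows "s = t"
proof -
  have "(s, t) \<in> r" "(t, s) \<in> r"
    using assms(2,3) by (auto simp: is_sup_def)
  then show ?thesis
    using assms(1) by (auto simp: partial_order_on_def antisym_def)
qed

lemma sup_in_eqI:
  assumes "partial_order_on P r" "is_sup P r A s"
  shows "sup_in P r A = s"
  unfolding sup_in_def using assms is_sup_unique by (metis the_equality)

text \<open>The order reverses the convention in which the closure of a point is its down-set: here open sets
  are closed downwards and the closure of a point is the set of its upper bounds.\<close>

definition specialization_rel :: "'a topology \<Rightarrow> 'a rel" where
  "specialization_rel X = {(x, y). x \<in> topspace X \<and> y \<in> X closure_of {x}}"

lemma partial_order_specialization_rel:
  assumes "M_object (X, B)"
  shows "partial_order_on (topspace X) (specialization_rel X)"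
proof -
  have mb: "monoidal_base X B" using assms by (simp add: M_object_def)
  have r: "(x, y) \<in> specialization_rel X \<longleftrightarrow>
      x \<in> topspace X \<and> y \<in> topspace X \<and> (\<forall>U\<in>B. y \<in> U \<longrightarrow> x \<in> U)" for x y
    using in_closure_of_singleton_base[OF mb] by (auto simp: specialization_rel_def)
  show ?thesis
    unfolding partial_order_on_def preorder_on_def
  proof (intro conjI)
    show "antisym (specialization_rel X)"
      using t0_base_eqI[OF assms] by (auto simp: antisym_def r)
  qed (auto simp: refl_on_def trans_def r)
qed

lemma represents_is_sup:
  assumes "monoidal_base X B" "A \<subseteq> topspace X" "p \<in> topspace X" "represents B A p"
  shows "is_sup (topspace X) (specialization_rel X) A p"
  using assms(2-4) unfolding is_sup_def represents_def specialization_rel_def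
  by (auto simp: in_closure_of_singleton_base[OF assms(1)] subset_iff)

text \<open>From right to left the order is the specialization order, for which a supremum and a
  representing point of the same set coincide.\<close>

lemma M_complete_join_semilattice_iff:
  "M_complete_join_semilattice (X, B) \<longleftrightarrow> M_object (X, B) \<and> representable (X, B)"
proof (intro iffI conjI)
  assume "M_complete_join_semilattice (X, B)"
  then obtain r where ob: "M_object (X, B)" and r: "complete_join_semilattice (topspace X) r"
    and sup: "\<And>A U. A \<subseteq> topspace X \<Longrightarrow> U \<in> B \<Longrightarrow> A \<subseteq> U \<longleftrightarrow> sup_in (topspace X) r A \<in> U"
    by (auto simp: M_complete_join_semilattice_def)
  show "M_object (X, B)" by (fact ob)
  have "\<exists>p\<in>topspace X. represents B A p" if "A \<subseteq> topspace X" for A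
  proof -
    have po: "partial_order_on (topspace X) r"
      using r by (simp add: complete_join_semilattice_def)
    obtain s where s: "is_sup (topspace X) r A s"
      using r \<open>A \<subseteq> topspace X\<close> unfolding complete_join_semilattice_def by blast
    have "s \<in> topspace X" using s by (simp add: is_sup_def)
    moreover have "represents B A s"
      using sup[OF that] by (simp add: sup_in_eqI[OF po s] represents_def)
    ultimately show ?thesis by blast
  qed
  then show "representable (X, B)" by (simp add: representable_def)
next
  assume *: "M_object (X, B) \<and> representable (X, B)"
  let ?r = "specialization_rel X"
  have po: "partial_order_on (topspace X) ?r"
    using * partial_order_specialization_rel by blast
  have rep: "\<exists>p. is_sup (topspace X) ?r A p \<and> represents B A p" if "A \<subseteq> topspace X" for A
  proof -
    have mb: "monoidal_base X B" using * by (simp add: M_object_def)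
    obtain p where p: "p \<in> topspace X" "represents B A p"
      using * \<open>A \<subseteq> topspace X\<close> by (auto simp: representable_def)
    show ?thesis using represents_is_sup[OF mb that p] p(2) by blast
  qed
  have "complete_join_semilattice (topspace X) ?r"
    unfolding complete_join_semilattice_def
  proof (intro conjI allI impI)
    fix A assume "A \<subseteq> topspace X"
    then show "\<exists>s. is_sup (topspace X) ?r A s" using rep by blast
  qed (rule po)
  moreover have "A \<subseteq> U \<longleftrightarrow> sup_in (topspace X) ?r A \<in> U" if "A \<subseteq> topspace X" "U \<in> B" for A U
  proof -
    obtain p where p: "is_sup (topspace X) ?r A p" "represents B A p"
      using rep[OF \<open>A \<subseteq> topspace X\<close>] by blast
    then show ?thesis
      using that(2) unfolding sup_in_eqI[OF po p(1)] represents_def by blast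
  qed
  ultimately show "M_complete_join_semilattice (X, B)"
    unfolding M_complete_join_semilattice_def prod.case
    by (intro conjI exI[of _ ?r] allI impI ballI) (use * in simp_all)
qed

section \<open>Exponentials\<close>

abbreviation power_class :: "'a set set \<Rightarrow> 'a set \<Rightarrow> 'a set set" where
  "power_class B A \<equiv> same_opens (power_topology B) `` {A}"

lemma topspace_exponential:
  assumes "monoidal_base X B"
  shows "topspace (fst (exponential (X, B))) = power_class B ` Pow (topspace X)"
  by (auto simp: exponential_def Let_def topspace_quotient_topology[OF equiv_same_opens]
      topspace_power_topology[OF assms] quotient_def)

lemma snd_exponential:
  "snd (exponential (X, B)) = (\<lambda>U. power_class B ` Pow U) ` B"
  by (auto simp: exponential_def Let_def)

text \<open>The power sets of members of \<open>B\<close> form a base of the power space, so they suffice to separate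
  the points of that space that open sets can separate.\<close>

lemma power_class_eq_iff:
  assumes "monoidal_base X B" "A \<subseteq> topspace X" "A' \<subseteq> topspace X"
  shows "power_class B A = power_class B A' \<longleftrightarrow> (\<forall>U\<in>B. A \<subseteq> U \<longleftrightarrow> A' \<subseteq> U)"
proof -
  let ?T = "power_topology B"
  have base: "openin ?T = arbitrary union_of (\<lambda>S. \<exists>U\<in>B. S = Pow U)"
    by (rule openin_power_topology[OF assms(1)])
  have Pow_open: "openin ?T (Pow U)" if "U \<in> B" for U
    using base that unfolding openin_topology_base_unique by blast
  have refine: "\<exists>U\<in>B. S \<subseteq> U \<and> Pow U \<subseteq> V" if "openin ?T V" "S \<in> V" for S V
  proof -
    have "\<exists>W. (\<exists>U\<in>B. W = Pow U) \<and> S \<in> W \<and> W \<subseteq> V"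
      using base[unfolded openin_topology_base_unique] that by simp
    then show ?thesis by auto
  qed
  have top: "A \<in> topspace ?T" "A' \<in> topspace ?T"
    using topspace_power_topology[OF assms(1)] assms(2,3) by auto
  have "power_class B A = power_class B A' \<longleftrightarrow> (A, A') \<in> same_opens ?T"
    using eq_equiv_class_iff[OF equiv_same_opens top] .
  also have "\<dots> \<longleftrightarrow> (\<forall>V. openin ?T V \<longrightarrow> (A \<in> V \<longleftrightarrow> A' \<in> V))"
    using top by (simp add: same_opens_def)
  also have "\<dots> \<longleftrightarrow> (\<forall>U\<in>B. A \<subseteq> U \<longleftrightarrow> A' \<subseteq> U)"
  proof
    assume "\<forall>V. openin ?T V \<longrightarrow> (A \<in> V \<longleftrightarrow> A' \<in> V)"
    then show "\<forall>U\<in>B. A \<subseteq> U \<longleftrightarrow> A' \<subseteq> U" using Pow_open by (metis Pow_iff)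
  next
    assume "\<forall>U\<in>B. A \<subseteq> U \<longleftrightarrow> A' \<subseteq> U"
    then have "A \<in> V \<longleftrightarrow> A' \<in> V" if "openin ?T V" for V
      using refine[OF that] by (meson PowI subsetD)
    then show "\<forall>V. openin ?T V \<longrightarrow> (A \<in> V \<longleftrightarrow> A' \<in> V)" by blast
  qed
  finally show ?thesis .
qed

lemma power_class_in_iff:
  assumes "monoidal_base X B" "A \<subseteq> topspace X" "U \<in> B"
  shows "power_class B A \<in> power_class B ` Pow U \<longleftrightarrow> A \<subseteq> U"
proof
  assume "power_class B A \<in> power_class B ` Pow U"
  then obtain A' where A': "A' \<subseteq> U" "power_class B A = power_class B A'" by blast
  then have "A' \<subseteq> topspace X" using monoidal_base_subset assms by blast
  then show "A \<subseteq> U" using power_class_eq_iff[OF assms(1,2)] A' assms(3) by blast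
qed blast

text \<open>Pick a set from each class of a family. The class of the union of these sets represents the
  family, because the union is contained in \<open>U\<close> iff each of the sets is.\<close>

lemma representable_exponential:
  assumes "monoidal_base X B"
  shows "representable (exponential (X, B))"
proof -
  let ?E = "exponential (X, B)"
  have "\<exists>p\<in>topspace (fst ?E). represents (snd ?E) K p" if K: "K \<subseteq> topspace (fst ?E)" for K
  proof -
    obtain F where F: "F \<subseteq> Pow (topspace X)" "K = power_class B ` F"
      using K unfolding topspace_exponential[OF assms] by (meson subset_imageE)
    have "power_class B (\<Union>F) \<in> topspace (fst ?E)"
      unfolding topspace_exponential[OF assms] using F by blast
    moreover have "represents (snd ?E) K (power_class B (\<Union>F))"
      unfolding represents_def snd_exponential
    proof (rule ballI, elim imageE)
      fix W U assume W: "W = power_class B ` Pow U" "U \<in> B"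
      have "K \<subseteq> W \<longleftrightarrow> (\<forall>A\<in>F. power_class B A \<in> W)"
        using F by blast
      also have "\<dots> \<longleftrightarrow> (\<forall>A\<in>F. A \<subseteq> U)"
        using power_class_in_iff[OF assms] F(1) W by (meson PowD subsetD)
      also have "\<dots> \<longleftrightarrow> power_class B (\<Union>F) \<in> W"
        unfolding W(1) using power_class_in_iff[OF assms _ W(2), of "\<Union>F"] F(1) by blast
      finally show "K \<subseteq> W \<longleftrightarrow> power_class B (\<Union>F) \<in> W" .
    qed
    ultimately show ?thesis by blast
  qed
  then show ?thesis by (simp add: representable_def split_beta)
qed

text \<open>To represent \<open>A\<close>, push it forward, take a representing point there, and pull that point back;
  sets of the base are compared by taking preimages under the inverse.\<close>

lemma representable_isomorphic:
  assumes "P \<cong>\<^sub>M Q" "representable Q"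
  shows "representable P"
proof -
  obtain X B Y C where PQ: "P = (X, B)" "Q = (Y, C)" by fastforce
  obtain f g where f: "f \<in> topspace X \<rightarrow> topspace Y" and g: "g \<in> topspace Y \<rightarrow> topspace X"
    and pre: "\<And>U. U \<in> B \<Longrightarrow> {y \<in> topspace Y. g y \<in> U} \<in> C"
    and gf: "\<And>x. x \<in> topspace X \<Longrightarrow> g (f x) = x"
    using assms(1) unfolding PQ M_isomorphic_def M_morphism_def by auto
  have "\<exists>p\<in>topspace X. represents B A p" if A: "A \<subseteq> topspace X" for A
  proof -
    have "f ` A \<subseteq> topspace Y" using f A by blast
    then obtain q where q: "q \<in> topspace Y" "represents C (f ` A) q"
      using assms(2) unfolding PQ representable_def by auto
    have "A \<subseteq> U \<longleftrightarrow> g q \<in> U" if "U \<in> B" for U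
    proof -
      have "A \<subseteq> U \<longleftrightarrow> f ` A \<subseteq> {y \<in> topspace Y. g y \<in> U}"
        using f gf A by (auto simp: subset_iff Pi_iff)
      also have "\<dots> \<longleftrightarrow> g q \<in> U"
        using q pre[OF that] by (auto simp: represents_def)
      finally show ?thesis .
    qed
    then show ?thesis using q g by (auto simp: represents_def)
  qed
  then show ?thesis by (simp add: PQ representable_def)
qed

text \<open>If \<open>p\<close> represents \<open>A\<close>, then \<open>{p}\<close> and \<open>A\<close> have the same class, so \<open>x \<mapsto> [{x}]\<close> is onto; it is injective
  because the space is \<open>T\<^sub>0\<close>.\<close>

lemma representable_imp_isomorphic_exponential:
  assumes ob: "M_object (X, B)" and rep: "representable (X, B)"
  shows "(X, B) \<cong>\<^sub>M exponential (X, B)"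
proof -
  have mb: "monoidal_base X B" using ob by (simp add: M_object_def)
  obtain Q C where E: "exponential (X, B) = (Q, C)" by fastforce
  have obQ: "M_object (Q, C)" using M_object_exponential[OF ob] E by simp
  have topQ: "topspace Q = power_class B ` Pow (topspace X)"
    using topspace_exponential[OF mb] E by simp
  have C: "C = (\<lambda>U. power_class B ` Pow U) ` B" using snd_exponential[of X B] E by simp
  define f where "f x = power_class B {x}" for x
  define g where "g = inv_into (topspace X) f"
  have f_in: "f x \<in> power_class B ` Pow U \<longleftrightarrow> x \<in> U" if "x \<in> topspace X" "U \<in> B" for x U
    unfolding f_def using power_class_in_iff[OF mb, of "{x}" U] that by simp
  have inj: "inj_on f (topspace X)"
    by (rule inj_onI, rule t0_base_eqI[OF ob]) (use f_in in metis)+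
  have surj: "f ` topspace X = topspace Q"
  proof (intro equalityI subsetI)
    fix c assume "c \<in> f ` topspace X"
    then show "c \<in> topspace Q" unfolding topQ f_def by blast
  next
    fix c assume "c \<in> topspace Q"
    then obtain A where A: "A \<subseteq> topspace X" "c = power_class B A" using topQ by blast
    then obtain p where p: "p \<in> topspace X" "represents B A p"
      using rep by (auto simp: representable_def)
    then have "c = f p"
      using A power_class_eq_iff[OF mb, of A "{p}"] by (simp add: f_def represents_def)
    then show "c \<in> f ` topspace X" using p by blast
  qed
  have gf: "g (f x) = x" if "x \<in> topspace X" for x
    using inj that by (simp add: g_def)
  have fg: "f (g c) = c" "g c \<in> topspace X" if "c \<in> topspace Q" for c
    using that surj by (auto simp: g_def f_inv_into_f inv_into_into)
  have "M_morphism (X, B) (Q, C) f"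
    unfolding M_morphism_def
  proof (clarsimp simp: ob obQ, intro conjI ballI)
    show "f \<in> topspace X \<rightarrow> topspace Q" using surj by blast
    fix W assume "W \<in> C"
    then obtain U where U: "U \<in> B" "W = power_class B ` Pow U" using C by blast
    then have "{x \<in> topspace X. f x \<in> W} = U"
      using f_in monoidal_base_subset[OF mb] by blast
    then show "{x \<in> topspace X. f x \<in> W} \<in> B" using U by simp
  qed
  moreover have "M_morphism (Q, C) (X, B) g"
    unfolding M_morphism_def
  proof (clarsimp simp: ob obQ, intro conjI ballI)
    show "g \<in> topspace Q \<rightarrow> topspace X" using fg by blast
    fix U assume U: "U \<in> B"
    have "power_class B ` Pow U \<subseteq> topspace Q"
      unfolding topQ using monoidal_base_subset[OF mb U] by blast
    moreover have "c \<in> power_class B ` Pow U \<longleftrightarrow> g c \<in> U" if "c \<in> topspace Q" for c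
      using f_in[OF fg(2)[OF that] U] fg(1)[OF that] by simp
    ultimately have "{c \<in> topspace Q. g c \<in> U} = power_class B ` Pow U" by blast
    then show "{c \<in> topspace Q. g c \<in> U} \<in> C" using U C by blast
  qed
  ultimately show ?thesis
    unfolding M_isomorphic_def E by (intro exI[of _ f] exI[of _ g]) (simp add: gf fg)
qed

section \<open>The equivalence\<close>

(* HOL cannot quantify existentially over the type of points of Y inside a formula.  So (5) occurs
   with Y on the type 'a of points of X (c5) as one of the equivalent conditions, and with Y on an
   arbitrary type 'b (c5') as a hypothesis implying them. *)
theorem theorem2p10:
  fixes X :: "'a topology"
  assumes "t0_space X"
  shows
    "let c1 = (monoidal_base X (open_blobs X) \<and>
               (\<forall>A\<subseteq>topspace X. \<exists>p\<in>topspace X.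
                  topspace X \<inter> (\<Inter>x\<in>A. X closure_of {x}) = X closure_of {p}));
         c2 = M_complete_join_semilattice (X, open_blobs X);
         c3 = (\<exists>B. monoidal_base X B \<and> M_complete_join_semilattice (X, B));
         c4 = (\<exists>B. monoidal_base X B \<and> (X, B) \<cong>\<^sub>M exponential (X, B));
         c5 = (\<exists>B. monoidal_base X B \<and>
                (\<exists>(Y :: 'a topology) C. M_object (Y, C) \<and> (X, B) \<cong>\<^sub>M exponential (Y, C)));
         c5' = (\<exists>B. monoidal_base X B \<and>
                (\<exists>(Y :: 'b topology) C. M_object (Y, C) \<and> (X, B) \<cong>\<^sub>M exponential (Y, C)))
     in (c1 \<longleftrightarrow> c2) \<and> (c2 \<longleftrightarrow> c3) \<and> (c3 \<longleftrightarrow> c4) \<and> (c4 \<longleftrightarrow> c5) \<and> (c5' \<longrightarrow> c5)"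
proof -
  define S where "S \<longleftrightarrow> (\<exists>B. M_object (X, B) \<and> representable (X, B))"
  have ob: "M_object (X, B) \<longleftrightarrow> monoidal_base X B" for B
    using assms by (simp add: M_object_def)
  have c1: "monoidal_base X (open_blobs X) \<and>
      (\<forall>A\<subseteq>topspace X. \<exists>p\<in>topspace X.
         topspace X \<inter> (\<Inter>x\<in>A. X closure_of {x}) = X closure_of {p})
    \<longleftrightarrow> M_object (X, open_blobs X) \<and> representable (X, open_blobs X)" (is "?l \<longleftrightarrow> ?r")
  proof
    assume l: ?l
    have "\<exists>p\<in>topspace X. represents (open_blobs X) A p" if A: "A \<subseteq> topspace X" for A
    proof -
      obtain p where p: "p \<in> topspace X"
        and "topspace X \<inter> (\<Inter>x\<in>A. X closure_of {x}) = X closure_of {p}"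
        using l A by meson
      from closure_imp_represents_open_blobs[OF A this] show ?thesis using p by blast
    qed
    then show ?r using l unfolding ob representable_def prod.case by blast
  next
    assume ?r
    then have mb: "monoidal_base X (open_blobs X)"
      and rep: "\<And>A. A \<subseteq> topspace X \<Longrightarrow> \<exists>p\<in>topspace X. represents (open_blobs X) A p"
      by (simp_all add: ob representable_def)
    show ?l
      using mb rep Inter_closures_eq_closure_of_representing[OF mb] by (intro conjI allI impI) meson+
  qed
  have blobs: "M_object (X, open_blobs X) \<and> representable (X, open_blobs X) \<longleftrightarrow> S"
    unfolding S_def using representable_base_eq_open_blobs ob by metis
  have c3: "(\<exists>B. monoidal_base X B \<and> M_complete_join_semilattice (X, B)) \<longleftrightarrow> S"
    unfolding S_def M_complete_join_semilattice_iff ob by blast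
  have to_exp: "\<exists>B. monoidal_base X B \<and> (X, B) \<cong>\<^sub>M exponential (X, B)" if S
    using that representable_imp_isomorphic_exponential ob unfolding S_def by blast
  have from_exp: S if "monoidal_base X B" "M_object (Y, C)" "(X, B) \<cong>\<^sub>M exponential (Y, C)"
    for B C and Y :: "'a topology"
  proof -
    have "monoidal_base Y C" using that(2) by (simp add: M_object_def)
    then have "representable (X, B)"
      by (intro representable_isomorphic[OF that(3)] representable_exponential)
    then show S unfolding S_def using that(1) ob by blast
  qed
  have from_exp': S if "monoidal_base X B" "M_object (Y, C)" "(X, B) \<cong>\<^sub>M exponential (Y, C)"
    for B C and Y :: "'b topology"
  proof -
    have "monoidal_base Y C" using that(2) by (simp add: M_object_def)
    then have "representable (X, B)"
      by (intro representable_isomorphic[OF that(3)] representable_exponential)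
    then show S unfolding S_def using that(1) ob by blast
  qed
  have c4: "(\<exists>B. monoidal_base X B \<and> (X, B) \<cong>\<^sub>M exponential (X, B)) \<longleftrightarrow> S"
    using to_exp from_exp ob by blast
  have c5: "(\<exists>B. monoidal_base X B \<and>
      (\<exists>(Y :: 'a topology) C. M_object (Y, C) \<and> (X, B) \<cong>\<^sub>M exponential (Y, C))) \<longleftrightarrow> S"
    using to_exp from_exp ob by blast
  have c5': "(\<exists>B. monoidal_base X B \<and>
      (\<exists>(Y :: 'b topology) C. M_object (Y, C) \<and> (X, B) \<cong>\<^sub>M exponential (Y, C))) \<longrightarrow> S"
    using from_exp' by blast
  show ?thesis
    unfolding Let_def c1 M_complete_join_semilattice_iff[of X "open_blobs X"] blobs c3 c4 c5
    using c5' by simp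
qed

end
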